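(* Let $R$ be a finite commutative ring with identity and let $J(R)$ be the Jacobson radical of $R$. For any $x,y\in R$, if $x+J(R)$ is adjacent to $y+J(R)$ in the unit-zero divisor graph $G_{UZ}(R/J(R))$, then every element of the coset $x+J(R)$ is adjacent to every element of the coset $y+J(R)$ in $G_{UZ}(R)$.
   Context: For a finite commutative ring $S$ with identity, $U(S)$ is the set of units and $Z(S)$ is the set of zero divisors, with the convention $0\in Z(S)$. The unit-zero divisor graph $G_{UZ}(S)$ is the simple undirected graph whose vertex set is the set of all elements of $S$, where two distinct vertices $u,v$ are adjacent if and only if $u+v\in U(S)$ and $uv\in Z(S)$. The Jacobson radical $J(R)$ is the intersection of all maximal ideals of $R$. *)

theory Defs
  imports "HOL-Algebra.QuotRing" "Graph_Theory.Pair_Digraph"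
begin

text \<open>
  The intersection is relativised to the carrier, because the zero ring has no maximal
  ideals and the empty intersection has to be the whole ring.
\<close>
definition jacobson_radical :: "('a, 'b) ring_scheme \<Rightarrow> 'a set" where
  "jacobson_radical R = carrier R \<inter> \<Inter>{M. maximalideal M R}"

text \<open>Zero is counted as a zero divisor, also in the zero ring.\<close>
definition zero_divisors :: "('a, 'b) ring_scheme \<Rightarrow> 'a set" where
  "zero_divisors R = {a \<in> carrier R.
     a = \<zero>\<^bsub>R\<^esub> \<or> (\<exists>b \<in> carrier R. b \<noteq> \<zero>\<^bsub>R\<^esub> \<and> a \<otimes>\<^bsub>R\<^esub> b = \<zero>\<^bsub>R\<^esub>)}"

text \<open>
  A simple undirected graph is represented, as in the graph library, by a loop-free symmetric
  digraph: the undirected edge between \<open>u\<close> and \<open>v\<close> is the pair of arcs \<open>(u, v)\<close> and \<open>(v, u)\<close>.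
  The lemma \<open>pair_graph_unit_zero_divisor_graph\<close> shows that this is a graph in that sense.
\<close>
definition unit_zero_divisor_graph :: "('a, 'b) ring_scheme \<Rightarrow> 'a pair_pre_digraph" where
  "unit_zero_divisor_graph S =
    \<lparr> pverts = carrier S,
      parcs = {(u, v). u \<in> carrier S \<and> v \<in> carrier S \<and> u \<noteq> v \<and>
                 u \<oplus>\<^bsub>S\<^esub> v \<in> Units S \<and> u \<otimes>\<^bsub>S\<^esub> v \<in> zero_divisors S} \<rparr>"

lemma pair_graph_unit_zero_divisor_graph:
  assumes "cring S" and "finite (carrier S)"
  shows "pair_graph (unit_zero_divisor_graph S)"
proof -
  interpret cring S by fact
  have "parcs (unit_zero_divisor_graph S) \<subseteq> carrier S \<times> carrier S"
    by (auto simp: unit_zero_divisor_graph_def)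
  then have "finite (parcs (unit_zero_divisor_graph S))"
    using assms(2) by (meson finite_SigmaI finite_subset)
  moreover have "symmetric (with_proj (unit_zero_divisor_graph S))"
    by (auto simp: symmetric_def sym_def unit_zero_divisor_graph_def a_comm m_comm)
  ultimately show ?thesis
    using assms(2) by unfold_locales (auto simp: unit_zero_divisor_graph_def)
qed

end

theory Submission
  imports Defs "HOL-Algebra.Ring_Divisibility"
begin

text \<open>
  In a finite commutative ring every element is a unit or a zero divisor, and an element is a
  unit as soon as it is a unit modulo the Jacobson radical \<open>J\<close>, since otherwise a maximal ideal
  would contain both it and \<open>J\<close>, hence also \<open>\<one>\<close>. So the unit condition lifts. If the product were
  not a zero divisor, it would be a unit, and so would its image in the quotient; that image is
  a zero divisor as well, which forces the quotient to be the zero ring, whose graph has no edges.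
\<close>

text \<open>Finiteness takes the place of Zorn's lemma: there are only finitely many proper ideals,
  so one that is maximal for inclusion lies above \<open>I\<close>.\<close>

lemma (in cring) ideal_subset_maximalideal:
  assumes fin: "finite (carrier R)" and I: "ideal I R" "I \<noteq> carrier R"
  obtains M where "maximalideal M R" "I \<subseteq> M"
proof -
  let ?S = "{K. ideal K R \<and> K \<noteq> carrier R}"
  have "?S \<subseteq> Pow (carrier R)"
    by (auto dest: ideal.Icarr)
  then have "finite ?S"
    using fin by (meson finite_Pow_iff finite_subset)
  then obtain M where M: "M \<in> ?S" "I \<subseteq> M" and max: "\<And>K. K \<in> ?S \<Longrightarrow> M \<subseteq> K \<Longrightarrow> M = K"
    using finite_has_maximal2[of ?S I] I by auto
  have "maximalideal M R"
    using M max by (intro maximalidealI) auto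
  with M that show thesis by blast
qed

text \<open>The principal ideal of a nonunit is proper, so it extends to a maximal ideal.\<close>

lemma (in cring) nonunit_in_maximalideal:
  assumes "finite (carrier R)" "a \<in> carrier R" "a \<notin> Units R"
  obtains M where "maximalideal M R" "a \<in> M"
proof -
  have "PIdl a \<noteq> carrier R"
    using assms ideal_eq_carrier_iff by metis
  then show thesis
    using ideal_subset_maximalideal[OF assms(1) cgenideal_ideal] cgenideal_self assms that by blast
qed

lemma (in ring) ideal_jacobson_radical: "ideal (jacobson_radical R) R"
proof -
  \<comment> \<open>Inserting the whole ring keeps the family nonempty even for the zero ring, and
    matches the intersection with the carrier in \<open>jacobson_radical\<close>.\<close>
  have "ideal (\<Inter>(insert (carrier R) {M. maximalideal M R})) R"
    using oneideal maximalideal.axioms(1) by (intro i_Intersect) blast+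
  then show ?thesis
    by (simp add: jacobson_radical_def)
qed

lemma (in cring) Units_lift_jacobson_radical:
  assumes fin: "finite (carrier R)" and a: "a \<in> carrier R"
    and unit: "jacobson_radical R +> a \<in> Units (R Quot jacobson_radical R)"
  shows "a \<in> Units R"
proof (rule ccontr)
  let ?J = "jacobson_radical R"
  interpret J: ideal ?J R by (rule ideal_jacobson_radical)
  assume "a \<notin> Units R"
  then obtain M where M: "maximalideal M R" "a \<in> M"
    using nonunit_in_maximalideal[OF fin a] by blast
  interpret M: maximalideal M R by fact
  \<comment> \<open>Here \<open>c\<close> is a representative of the inverse coset.\<close>
  obtain c where c: "c \<in> carrier R" "[mod ?J:] (?J +> a) \<Otimes> (?J +> c) = ?J +> \<one>"
    using unit by (auto simp: Units_def FactRing_simps)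
  then have "?J +> \<one> = ?J +> (a \<otimes> c)"
    using a by (simp add: J.rcoset_mult_add)
  then have "\<one> \<ominus> a \<otimes> c \<in> ?J"
    using quotient_eq_iff_same_a_r_cos[OF J.is_ideal] a c(1) by simp
  then have "\<one> \<ominus> a \<otimes> c \<in> M"
    using M(1) unfolding jacobson_radical_def by blast
  \<comment> \<open>Since \<open>a\<close> lies in \<open>M\<close>, so does
    \<open>a \<otimes> c\<close>; adding it back puts \<open>\<one>\<close> into the proper ideal
    \<open>M\<close>.\<close>
  then have "(\<one> \<ominus> a \<otimes> c) \<oplus> a \<otimes> c \<in> M"
    using M c(1) by (intro M.a_closed M.I_r_closed)
  moreover have "(\<one> \<ominus> a \<otimes> c) \<oplus> a \<otimes> c = \<one>"
    using a c(1) by algebra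
  ultimately show False
    using M.one_imp_carrier M.I_notcarr by simp
qed

text \<open>If only zero annihilates \<open>a\<close>, multiplication by \<open>a\<close> is
  injective, hence surjective on the finite carrier, and a preimage of \<open>\<one>\<close> is an
  inverse.\<close>

lemma (in cring) Units_or_zero_divisors:
  assumes fin: "finite (carrier R)" and a: "a \<in> carrier R"
  shows "a \<in> Units R \<or> a \<in> zero_divisors R"
proof (rule disjCI)
  assume nz: "a \<notin> zero_divisors R"
  have "inj_on ((\<otimes>) a) (carrier R)"
  proof (rule inj_onI)
    fix b c assume bc: "b \<in> carrier R" "c \<in> carrier R" "a \<otimes> b = a \<otimes> c"
    then have "a \<otimes> (b \<ominus> c) = \<zero>"
      using a by algebra
    then have "b \<ominus> c = \<zero>"
      using nz a bc minus_closed unfolding zero_divisors_def by blast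
    then show "b = c"
      using bc by simp
  qed
  moreover have "(\<otimes>) a ` carrier R \<subseteq> carrier R"
    using a by auto
  ultimately have "(\<otimes>) a ` carrier R = carrier R"
    using fin by (simp add: endo_inj_surj)
  then obtain b where "b \<in> carrier R" "a \<otimes> b = \<one>"
    by (metis imageE one_closed)
  moreover from this have "b \<otimes> a = \<one>"
    using a by (simp add: m_comm)
  ultimately show "a \<in> Units R"
    using a by (auto simp: Units_def)
qed

text \<open>A unit can be cancelled from \<open>a \<otimes> c = \<zero>\<close>, which leaves only
  the case \<open>a = \<zero>\<close>. The conclusion is not a contradiction because in the zero
  ring \<open>\<zero>\<close> is both a unit and, by convention, a zero divisor.\<close>

lemma (in cring) Units_Int_zero_divisors:
  assumes "a \<in> Units R" "a \<in> zero_divisors R"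
  shows "\<one> = \<zero>"
proof -
  obtain b where b: "b \<in> carrier R" "b \<otimes> a = \<one>"
    using assms(1) by (auto simp: Units_def)
  have "c = \<zero>" if "c \<in> carrier R" "a \<otimes> c = \<zero>" for c
    using that b assms(1) by (metis Units_closed l_one m_assoc r_null)
  moreover have "\<one> = \<zero>" if "a = \<zero>"
    using that b by simp
  ultimately show ?thesis
    using assms(2) unfolding zero_divisors_def by blast
qed

lemma (in ring_hom_ring) hom_Units:
  assumes "a \<in> Units R"
  shows "h a \<in> Units S"
proof -
  obtain b where "b \<in> carrier R" "b \<otimes> a = \<one>" "a \<otimes> b = \<one>"
    using assms by (auto simp: Units_def)
  then have "h b \<otimes>\<^bsub>S\<^esub> h a = \<one>\<^bsub>S\<^esub>" "h a \<otimes>\<^bsub>S\<^esub> h b = \<one>\<^bsub>S\<^esub>" "h b \<in> carrier S" "h a \<in> carrier S"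
    using assms by (metis R.Units_closed hom_mult hom_one hom_closed)+
  then show ?thesis
    by (auto simp: Units_def)
qed

theorem theorem3p16:
  fixes R :: "('a, 'b) ring_scheme" and x y :: 'a
  assumes "cring R" and "finite (carrier R)"
    and "x \<in> carrier R" and "y \<in> carrier R"
    and "(jacobson_radical R +>\<^bsub>R\<^esub> x)
           \<rightarrow>\<^bsub>with_proj (unit_zero_divisor_graph (R Quot jacobson_radical R))\<^esub>
         (jacobson_radical R +>\<^bsub>R\<^esub> y)"
  shows "\<forall>a \<in> jacobson_radical R +>\<^bsub>R\<^esub> x. \<forall>b \<in> jacobson_radical R +>\<^bsub>R\<^esub> y.
           a \<rightarrow>\<^bsub>with_proj (unit_zero_divisor_graph R)\<^esub> b"
proof (intro ballI)
  let ?J = "jacobson_radical R"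
  let ?Q = "R Quot ?J"
  let ?q = "(+>\<^bsub>R\<^esub>) ?J"
  interpret cring R by fact
  interpret J: ideal ?J R by (rule ideal_jacobson_radical)
  interpret Q: cring ?Q by (rule J.quotient_is_cring) fact
  interpret q: ring_hom_ring R ?Q ?q by (rule J.rcos_ring_hom_ring)
  fix a b assume a: "a \<in> ?q x" and b: "b \<in> ?q y"
  then have ab: "a \<in> carrier R" "b \<in> carrier R"
    using assms(3,4) a_r_coset_subset_G[OF J.a_subset] by blast+
  \<comment> \<open>A coset is determined by any of its elements, so the given edge can be restated
    for the representatives \<open>a\<close> and \<open>b\<close>.\<close>
  have q: "?q a = ?q x" "?q b = ?q y"
    using a b assms(3,4) by (metis a_repr_independence J.a_subgroup)+
  have edge: "?q a \<noteq> ?q b" "?q a \<oplus>\<^bsub>?Q\<^esub> ?q b \<in> Units ?Q"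
      "?q a \<otimes>\<^bsub>?Q\<^esub> ?q b \<in> zero_divisors ?Q"
    using assms(5) unfolding q by (auto simp: unit_zero_divisor_graph_def)
  have "a \<oplus>\<^bsub>R\<^esub> b \<in> Units R"
    using edge(2) ab assms(2) by (intro Units_lift_jacobson_radical) auto
  moreover have "a \<otimes>\<^bsub>R\<^esub> b \<in> zero_divisors R"
  proof (rule ccontr)
    assume "a \<otimes>\<^bsub>R\<^esub> b \<notin> zero_divisors R"
    then have "a \<otimes>\<^bsub>R\<^esub> b \<in> Units R"
      using Units_or_zero_divisors[OF assms(2)] ab by blast
    then have "?q a \<otimes>\<^bsub>?Q\<^esub> ?q b \<in> Units ?Q"
      using q.hom_Units q.hom_mult[OF ab] by metis
    then have "\<one>\<^bsub>?Q\<^esub> = \<zero>\<^bsub>?Q\<^esub>"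
      using edge(3) Q.Units_Int_zero_divisors by blast
    then have "carrier ?Q = {\<zero>\<^bsub>?Q\<^esub>}"
      by (rule Q.one_zeroD)
    then show False
      using edge(1) ab q.hom_closed by blast
  qed
  \<comment> \<open>Adjacency also needs \<open>a\<close> and \<open>b\<close> distinct, which holds
    because their cosets differ.\<close>
  ultimately show "a \<rightarrow>\<^bsub>with_proj (unit_zero_divisor_graph R)\<^esub> b"
    using ab edge(1) by (auto simp: unit_zero_divisor_graph_def)
qed

end
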